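(* The equation $S\!E_3(a,b,c,g)$ (the Dotsenko-Fateev equation) admits shift operators for each of the shifts $a\to a\pm1$, $b\to b\pm1$, $c\to c\pm1$ and $g\to g\pm2$ (in each shift the other three parameters are kept fixed).
   Context: Notation: $\partial=d/dx$, $\theta=x\partial$, $\delta=a+b+c$; $a,b,c,g$ are complex parameters, assumed generic. The operator $S\!E_3=S\!E_3(a,b,c,g)$: put $e_1=a+c+1$, $e_2=2a+2c+g+2$, $e_3=b+c+1$, $e_4=2b+2c+g+2$, $e_5=-2c$, $e_6=-\delta-c-g-1$, $e_7=-2\delta-g-2$. Then $S\!E_3=x\,S_n(\theta)+S_0(\theta)+S_1(\theta)\partial$ with $S_n=(\theta+e_5)(\theta+e_6)(\theta+e_7)$, $S_0=-2\theta^3+(2e_1+2e_2+e_3+e_4-3)\theta^2+\bigl(-e_1e_2+(e_3-1)(e_4-1)-e_5e_6-e_6e_7-e_7e_5\bigr)\theta+c(2a+2c+g+1)(2\delta+g+2)$, $S_1=(\theta-e_1+1)(\theta-e_2+1)$. Shift operator: let $E(\mathbf a)\in\mathbb C(x)[\partial]$ be an operator of order $n$ depending on parameters $\mathbf a$ and let $\mathbf a\to sh(\mathbf a)$ be a shift of the parameters. A shift operator of $E$ for this shift is a non-zero operator $P\in\mathbb C(x)[\partial]$ of order lower than $n$ that sends the solution space of $E(\mathbf a)$ into that of $E(sh(\mathbf a))$; equivalently, there is $Q\in\mathbb C(x)[\partial]$ with $E(sh(\mathbf a))\circ P=Q\circ E(\mathbf a)$. *)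

theory Defs
  imports Complex_Main
    "HOL-Computational_Algebra.Polynomial"
    "HOL-Computational_Algebra.Fraction_Field"
begin

type_synonym ratfun = "complex poly fract"

section \<open>The derivation $d/dx$ on $\mathbb{C}(x)$\<close>

lift_definition ratfun_deriv :: "ratfun \<Rightarrow> ratfun"
  is "\<lambda>r. (pderiv (fst r) * snd r - fst r * pderiv (snd r), snd r * snd r)"
proof -
  fix r s :: "complex poly \<times> complex poly"
  assume "fractrel r s"
  then obtain p q u v where rs: "r = (p, q)" "s = (u, v)" and nz: "q \<noteq> 0" "v \<noteq> 0"
    and eq: "p * v = u * q"
    by (cases r; cases s) auto
  have d: "pderiv p * v + p * pderiv v = pderiv u * q + u * pderiv q"
    using arg_cong[OF eq, of pderiv] by (simp add: pderiv_mult algebra_simps)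
  have "(pderiv p * q - p * pderiv q) * (v * v) = (pderiv p * v) * (q * v) - (p * v) * pderiv q * v"
    by (simp add: algebra_simps)
  also have "\<dots> = (pderiv u * q + u * pderiv q - p * pderiv v) * (q * v) - (u * q) * pderiv q * v"
    using d eq by (metis add_diff_cancel_right')
  also have "\<dots> = pderiv u * q * q * v - (p * v) * pderiv v * q"
    by (simp add: algebra_simps)
  also have "\<dots> = (pderiv u * v - u * pderiv v) * (q * q)"
    unfolding eq by (simp add: algebra_simps)
  finally show "fractrel (pderiv (fst r) * snd r - fst r * pderiv (snd r), snd r * snd r)
      (pderiv (fst s) * snd s - fst s * pderiv (snd s), snd s * snd s)"
    using rs nz by simp
qed

lemma ratfun_deriv_Fract:
  "q \<noteq> 0 \<Longrightarrow> ratfun_deriv (Fract p q) = Fract (pderiv p * q - p * pderiv q) (q * q)"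
  by transfer simp

lemma ratfun_deriv_add: "ratfun_deriv (f + g) = ratfun_deriv f + ratfun_deriv g"
  by (cases f; cases g)
    (simp add: ratfun_deriv_Fract eq_fract pderiv_add pderiv_mult algebra_simps)

lemma ratfun_deriv_mult: "ratfun_deriv (f * g) = ratfun_deriv f * g + f * ratfun_deriv g"
  by (cases f; cases g) (simp add: ratfun_deriv_Fract eq_fract pderiv_mult algebra_simps)

lemma ratfun_deriv_0 [simp]: "ratfun_deriv 0 = 0"
  by (simp add: Zero_fract_def ratfun_deriv_Fract eq_fract)

lemma ratfun_deriv_1 [simp]: "ratfun_deriv 1 = 0"
  by (simp add: One_fract_def Zero_fract_def ratfun_deriv_Fract eq_fract)

section \<open>The ring $\mathbb{C}(x)[\partial]$\<close>

text \<open>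
  The operator $\sum_i r_i \partial^i$ is represented by the polynomial with coefficients $r_i$;
  the ring multiplication, defined below, is composition of operators and not
  multiplication of polynomials.
\<close>

typedef diffop = "UNIV :: ratfun poly set"
  morphisms coeffs_of Diffop ..

setup_lifting type_definition_diffop

text \<open>$\partial \circ (\sum_i r_i \partial^i) = \sum_i (r_i' \partial^i + r_i \partial^{i+1})$.\<close>

definition dmul :: "ratfun poly \<Rightarrow> ratfun poly" where
  "dmul q = map_poly ratfun_deriv q + pCons 0 q"

definition dcomp :: "ratfun poly \<Rightarrow> ratfun poly \<Rightarrow> ratfun poly" where
  "dcomp p q = (\<Sum>i\<le>degree p. smult (coeff p i) ((dmul ^^ i) q))"

lemma coeff_dmul:
  "coeff (dmul q) n = ratfun_deriv (coeff q n) + (case n of 0 \<Rightarrow> 0 | Suc k \<Rightarrow> coeff q k)"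
  by (simp add: dmul_def coeff_map_poly coeff_pCons split: nat.split)

lemma dmul_0 [simp]: "dmul 0 = 0"
  by (simp add: dmul_def)

lemma dmul_add: "dmul (p + q) = dmul p + dmul q"
  by (rule poly_eqI) (simp add: coeff_dmul ratfun_deriv_add split: nat.split)

lemma dmul_smult: "dmul (smult a q) = smult (ratfun_deriv a) q + smult a (dmul q)"
  by (rule poly_eqI) (simp add: coeff_dmul ratfun_deriv_mult algebra_simps split: nat.split)

lemma dmul_sum: "dmul (sum f A) = (\<Sum>i\<in>A. dmul (f i))"
  by (induction A rule: infinite_finite_induct) (simp_all add: dmul_add)

lemma dmul_pow_0 [simp]: "(dmul ^^ i) 0 = 0"
  by (induction i) simp_all

lemma dmul_pow_add: "(dmul ^^ i) (p + q) = (dmul ^^ i) p + (dmul ^^ i) q"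
  by (induction i) (simp_all add: dmul_add)

lemma dmul_pow_1: "(dmul ^^ i) 1 = monom 1 i"
proof (induction i)
  case (Suc i)
  have "dmul (monom 1 i) = monom 1 (Suc i)"
    by (rule poly_eqI) (auto simp: coeff_dmul split: nat.split)
  then show ?case using Suc by simp
qed (simp add: one_pCons monom_0)

lemma dcomp_bound:
  assumes "degree p \<le> n"
  shows "dcomp p q = (\<Sum>i\<le>n. smult (coeff p i) ((dmul ^^ i) q))"
  unfolding dcomp_def using assms
  by (intro sum.mono_neutral_left) (auto simp: coeff_eq_0)

lemma dcomp_add_left: "dcomp (p + p') q = dcomp p q + dcomp p' q"
proof -
  define n where "n = max (degree p) (degree p')"
  have "degree p \<le> n" "degree p' \<le> n" "degree (p + p') \<le> n"
    by (auto simp: n_def degree_add_le)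
  then show ?thesis
    by (simp add: dcomp_bound[of _ n] smult_add_left sum.distrib)
qed

lemma dcomp_add_right: "dcomp p (q + q') = dcomp p q + dcomp p q'"
  by (simp add: dcomp_def dmul_pow_add smult_add_right sum.distrib)

lemma dcomp_0_left [simp]: "dcomp 0 q = 0"
  by (simp add: dcomp_def)

lemma dcomp_0_right [simp]: "dcomp p 0 = 0"
  by (simp add: dcomp_def)

lemma smult_sum_poly: "smult a (sum f A) = (\<Sum>i\<in>A. smult a (f i))" for a :: ratfun
  by (induction A rule: infinite_finite_induct) (simp_all add: smult_add_right)

lemma dcomp_smult_left: "dcomp (smult a p) q = smult a (dcomp p q)"
  by (simp add: dcomp_bound[of _ "degree p"] smult_sum_poly)

lemma dcomp_sum_left: "dcomp (sum f A) q = (\<Sum>i\<in>A. dcomp (f i) q)"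
  by (induction A rule: infinite_finite_induct) (simp_all add: dcomp_add_left)

lemma dcomp_pCons_0: "dcomp (pCons 0 p) q = dcomp p (dmul q)"
proof -
  have "dcomp (pCons 0 p) q
      = (\<Sum>i\<le>Suc (degree p). smult (coeff (pCons 0 p) i) ((dmul ^^ i) q))"
    by (rule dcomp_bound) (rule degree_pCons_le)
  also have "\<dots> = (\<Sum>i\<le>degree p. smult (coeff p i) ((dmul ^^ i) (dmul q)))"
    by (simp only: sum.atMost_Suc_shift) (simp add: funpow_swap1)
  finally show ?thesis by (simp add: dcomp_def)
qed

lemma dcomp_dmul_left: "dcomp (dmul p) q = dmul (dcomp p q)"
proof -
  have "dcomp (map_poly ratfun_deriv p) q
      = (\<Sum>i\<le>degree p. smult (ratfun_deriv (coeff p i)) ((dmul ^^ i) q))"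
    by (subst dcomp_bound[of _ "degree p"])
      (auto intro!: degree_le simp: coeff_map_poly coeff_eq_0)
  moreover have "dcomp (pCons 0 p) q
      = (\<Sum>i\<le>degree p. smult (coeff p i) (dmul ((dmul ^^ i) q)))"
    by (simp add: dcomp_pCons_0) (simp add: dcomp_def funpow_swap1)
  ultimately show ?thesis
    by (simp add: dmul_def[of p] dcomp_add_left)
       (simp add: dcomp_def dmul_sum dmul_smult sum.distrib)
qed

lemma dcomp_assoc: "dcomp (dcomp p q) r = dcomp p (dcomp q r)"
proof -
  have "dcomp ((dmul ^^ i) q) r = (dmul ^^ i) (dcomp q r)" for i
    by (induction i) (simp_all add: dcomp_dmul_left)
  then show ?thesis
    by (simp add: dcomp_def[of p] dcomp_sum_left dcomp_smult_left)
qed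

lemma dcomp_1_left: "dcomp 1 q = q"
  by (simp add: dcomp_def)

lemma dcomp_1_right: "dcomp p 1 = p"
  by (simp add: dcomp_def dmul_pow_1 smult_monom poly_as_sum_of_monoms)

instantiation diffop :: ring_1
begin

lift_definition zero_diffop :: diffop is 0 .
lift_definition one_diffop :: diffop is 1 .
lift_definition plus_diffop :: "diffop \<Rightarrow> diffop \<Rightarrow> diffop" is plus .
lift_definition minus_diffop :: "diffop \<Rightarrow> diffop \<Rightarrow> diffop" is minus .
lift_definition uminus_diffop :: "diffop \<Rightarrow> diffop" is uminus .
lift_definition times_diffop :: "diffop \<Rightarrow> diffop \<Rightarrow> diffop" is dcomp .

instance
  by (standard; transfer)
    (simp_all add: dcomp_assoc dcomp_add_left dcomp_add_right dcomp_1_left dcomp_1_right)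

end

text \<open>The order is only meaningful for non-zero operators; by convention that of 0 is 0.\<close>

lift_definition ord_diffop :: "diffop \<Rightarrow> nat" is degree .

definition fun_op :: "ratfun \<Rightarrow> diffop" where
  "fun_op f = Diffop [:f:]"

definition partial_op :: diffop  (\<open>\<partial>\<close>) where
  "\<partial> = Diffop [:0, 1:]"

definition X_op :: diffop where
  "X_op = fun_op (Fract [:0, 1:] 1)"

definition const_op :: "complex \<Rightarrow> diffop" where
  "const_op k = fun_op (Fract [:k:] 1)"

definition \<theta> :: diffop where
  "\<theta> = X_op * \<partial>"

lemma coeffs_of_fun_op [simp]: "coeffs_of (fun_op f) = [:f:]"
  by (simp add: fun_op_def Diffop_inverse)

lemma coeffs_of_partial [simp]: "coeffs_of \<partial> = [:0, 1:]"
  by (simp add: partial_op_def Diffop_inverse)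

lemma fun_op_1: "fun_op 1 = 1"
  by (simp add: coeffs_of_inject[symmetric] one_diffop.rep_eq one_pCons)

lemma fun_op_add: "fun_op (f + g) = fun_op f + fun_op g"
  by (simp add: coeffs_of_inject[symmetric] plus_diffop.rep_eq)

lemma fun_op_mult: "fun_op (f * g) = fun_op f * fun_op g"
  by (simp add: coeffs_of_inject[symmetric] times_diffop.rep_eq dcomp_def)

lemma partial_fun_op: "\<partial> * fun_op f = fun_op f * \<partial> + fun_op (ratfun_deriv f)"
  by (simp add: coeffs_of_inject[symmetric] times_diffop.rep_eq plus_diffop.rep_eq
      dcomp_def dmul_def map_poly_pCons)

lemma partial_X_op: "\<partial> * X_op = X_op * \<partial> + 1"
  by (simp add: X_op_def partial_fun_op ratfun_deriv_Fract pderiv_pCons One_fract_def[symmetric]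
      one_pCons[symmetric] fun_op_1)

section \<open>The Dotsenko--Fateev operator\<close>

definition SE3 :: "complex \<Rightarrow> complex \<Rightarrow> complex \<Rightarrow> complex \<Rightarrow> diffop" where
  "SE3 a b c g =
    (let \<delta> = a + b + c;
         e1 = a + c + 1;
         e2 = 2 * a + 2 * c + g + 2;
         e3 = b + c + 1;
         e4 = 2 * b + 2 * c + g + 2;
         e5 = - 2 * c;
         e6 = - \<delta> - c - g - 1;
         e7 = - 2 * \<delta> - g - 2;
         Sn = (\<theta> + const_op e5) * (\<theta> + const_op e6) * (\<theta> + const_op e7);
         S0 = - 2 * \<theta> ^ 3
              + const_op (2 * e1 + 2 * e2 + e3 + e4 - 3) * \<theta> ^ 2
              + const_op (- e1 * e2 + (e3 - 1) * (e4 - 1) - e5 * e6 - e6 * e7 - e7 * e5) * \<theta>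
              + const_op (c * (2 * a + 2 * c + g + 1) * (2 * \<delta> + g + 2));
         S1 = (\<theta> + const_op (- e1 + 1)) * (\<theta> + const_op (- e2 + 1))
     in X_op * Sn + S0 + S1 * \<partial>)"

section \<open>Shift operators\<close>

text \<open>
  \<open>shift_operator E E' P\<close>: here \<open>E\<close> is the operator at the given parameters and \<open>E'\<close> the one at
  the shifted parameters.  The existence of \<open>Q\<close> expresses that \<open>P\<close> sends the solutions of \<open>E\<close>
  to solutions of \<open>E'\<close>.
\<close>

definition shift_operator :: "diffop \<Rightarrow> diffop \<Rightarrow> diffop \<Rightarrow> bool" where
  "shift_operator E E' P \<longleftrightarrow>
    P \<noteq> 0 \<and> ord_diffop P < ord_diffop E \<and> (\<exists>Q. E' * P = Q * E)"

definition admits_shift_operator :: "diffop \<Rightarrow> diffop \<Rightarrow> bool" where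
  "admits_shift_operator E E' \<longleftrightarrow> (\<exists>P. shift_operator E E' P)"

section \<open>Generic parameters\<close>

text \<open>
  A property holds for generic $(a,b,c,g) \in \mathbb{C}^4$ if it holds off the zero set of some
  non-zero polynomial.  The polynomials in four variables are the elements of
  $\mathbb{C}[g][c][b][a]$.
\<close>

definition poly4 ::
  "complex poly poly poly poly \<Rightarrow> complex \<Rightarrow> complex \<Rightarrow> complex \<Rightarrow> complex \<Rightarrow> complex" where
  "poly4 F a b c g = poly (poly (poly (poly F [:[:[:a:]:]:]) [:[:b:]:]) [:c:]) g"

definition generically ::
  "(complex \<Rightarrow> complex \<Rightarrow> complex \<Rightarrow> complex \<Rightarrow> bool) \<Rightarrow> bool" where
  "generically R \<longleftrightarrow>
    (\<exists>F. F \<noteq> 0 \<and> (\<forall>a b c g. poly4 F a b c g \<noteq> 0 \<longrightarrow> R a b c g))"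

end

theory Submission
  imports Defs
begin

text \<open>
  With respect to the grading of \<open>\<complex>[x, 1/x][\<partial>]\<close> by powers of \<open>x\<close>, the operator \<open>SE\<^sub>3\<close> has only
  the three components \<open>x\<^sup>-\<^sup>1 l(\<theta>) + m(\<theta>) + x h(\<theta>)\<close>.  For an ansatz \<open>P = \<Sum>\<^sub>j x\<^sup>j p\<^sub>j(\<theta>)\<close>,
  \<open>Q = \<Sum>\<^sub>j x\<^sup>j q\<^sub>j(\<theta>)\<close> the equation \<open>E' P = Q E\<close> becomes, because of \<open>p(\<theta>) x = x p(\<theta> + 1)\<close>, a
  finite list of identities between polynomials in the commuting variable \<open>\<theta>\<close>, and it is linear
  in the coefficients of \<open>P\<close> and \<open>Q\<close>.  The exponents at \<open>0\<close>, \<open>1\<close>, \<open>\<infinity>\<close> before and after the shift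
  bound the range of \<open>j\<close> and the pole of \<open>P\<close> at \<open>x = 1\<close>: for the shifts of \<open>b\<close>, \<open>c\<close> by \<open>-1\<close> and of \<open>g\<close>
  by \<open>-2\<close> there is a simple pole, and \<open>(x - 1) P\<close> is of the above form.  The explicit \<open>p\<^sub>j\<close> and \<open>q\<^sub>j\<close>
  were found by solving this linear system.  For the shifts of \<open>g\<close> the leading coefficient of \<open>P\<close>
  has factors depending on the parameters, whose zeros are excluded by genericity.
\<close>

section \<open>The grading by powers of $x$\<close>

abbreviation Xf :: ratfun where "Xf \<equiv> Fract [:0, 1:] 1"

lemma Xf_nz: "Xf \<noteq> 0"
  by (simp add: Zero_fract_def eq_fract)

section \<open>Constants and polynomials in \<theta>\<close>

lemma const_op_add: "const_op (k + l) = const_op k + const_op l"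
  by (simp add: const_op_def fun_op_add[symmetric])

lemma const_op_mult: "const_op (k * l) = const_op k * const_op l"
  by (simp add: const_op_def fun_op_mult[symmetric] mult.commute)

lemma const_op_0 [simp]: "const_op 0 = 0"
  using const_op_add[of 0 0] by simp

lemma const_op_1 [simp]: "const_op 1 = 1"
  by (simp add: const_op_def One_fract_def[symmetric] one_pCons[symmetric] fun_op_1)

lemma const_op_minus: "const_op (- k) = - const_op k"
  using const_op_add[of k "- k"] by (simp add: eq_neg_iff_add_eq_0 add.commute)

lemma fun_op_commute: "fun_op f * fun_op h = fun_op h * fun_op f"
  by (simp add: fun_op_mult[symmetric] mult.commute)

lemma const_op_commute_partial: "\<partial> * const_op k = const_op k * \<partial>"
proof -
  have "ratfun_deriv (Fract [:k:] 1) = 0"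
    by (simp add: ratfun_deriv_Fract Zero_fract_def eq_fract)
  moreover have "fun_op 0 = 0"
    using fun_op_add[of 0 0] by simp
  ultimately show ?thesis by (simp add: const_op_def partial_fun_op)
qed

lemma const_op_commute_\<theta>: "\<theta> * const_op k = const_op k * \<theta>"
  unfolding \<theta>_def mult.assoc const_op_commute_partial
  by (simp add: mult.assoc[symmetric] X_op_def const_op_def fun_op_commute)

definition ev :: "complex poly \<Rightarrow> diffop" where
  "ev p = fold_coeffs (\<lambda>k D. const_op k + \<theta> * D) p 0"

lemma ev_0 [simp]: "ev 0 = 0"
  by (simp add: ev_def)

lemma ev_pCons [simp]: "ev (pCons k p) = const_op k + \<theta> * ev p"
  by (cases "p = 0 \<and> k = 0") (auto simp: ev_def)

lemma ev_add: "ev (p + q) = ev p + ev q"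
  by (induction p q rule: poly_induct2) (simp_all add: const_op_add algebra_simps)

lemma ev_smult: "ev (smult k p) = const_op k * ev p"
  by (induction p)
    (simp_all add: const_op_mult distrib_left mult.assoc[symmetric] const_op_commute_\<theta>)

text \<open>Constants commute with \<theta>, so \<open>ev\<close> is a ring homomorphism onto a
  commutative subring; operator identities thereby reduce to identities in
  \<open>complex poly\<close>.\<close>

lemma ev_mult: "ev (p * q) = ev p * ev q"
  by (induction p) (simp_all add: ev_add ev_smult algebra_simps)

section \<open>Homogeneous operators x^k p(\<theta>)\<close>

definition gr :: "int \<Rightarrow> complex poly \<Rightarrow> diffop" where
  "gr k p = fun_op (Xf powi k) * ev p"

lemma \<theta>_Xf: "\<theta> * X_op = X_op * (\<theta> + 1)"
  by (simp add: \<theta>_def mult.assoc partial_X_op distrib_left)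

lemma fun_op_Xf_powi_add: "fun_op (Xf powi (k + l)) = fun_op (Xf powi k) * fun_op (Xf powi l)"
  by (simp add: fun_op_mult[symmetric] power_int_add Xf_nz)

lemma \<theta>_Xf_powi: "\<theta> * fun_op (Xf powi k) = fun_op (Xf powi k) * (\<theta> + const_op (of_int k))"
proof (induction k rule: int_induct[where k = 0])
  case base
  show ?case by (simp add: fun_op_1)
next
  case (step1 i)
  have i: "fun_op (Xf powi (i + 1)) = fun_op (Xf powi i) * X_op"
    using fun_op_Xf_powi_add[of i 1] by (simp add: X_op_def)
  have "\<theta> * fun_op (Xf powi (i + 1)) = \<theta> * fun_op (Xf powi i) * X_op"
    by (simp add: i mult.assoc)
  also have "\<dots> = fun_op (Xf powi i) * (\<theta> * X_op + const_op (of_int i) * X_op)"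
    by (simp add: step1 mult.assoc distrib_right)
  also have "const_op (of_int i) * X_op = X_op * const_op (of_int i)"
    by (simp add: X_op_def const_op_def fun_op_commute)
  also have "fun_op (Xf powi i) * (\<theta> * X_op + X_op * const_op (of_int i))
      = fun_op (Xf powi (i + 1)) * (\<theta> + const_op (of_int (i + 1)))"
    unfolding i by (simp add: \<theta>_Xf const_op_add distrib_left mult.assoc add_ac)
  finally show ?case .
next
  case (step2 i)
  \<comment> \<open>Downwards the relation is first verified after right multiplication by x, which
    is then cancelled by its inverse \<open>Y\<close>.\<close>
  define Y where "Y = fun_op (Xf powi (- 1))"
  have XY: "X_op * Y = 1"
    using fun_op_Xf_powi_add[of 1 "- 1"] by (simp add: Y_def X_op_def fun_op_1)
  have i: "fun_op (Xf powi i) = fun_op (Xf powi (i - 1)) * X_op"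
    using fun_op_Xf_powi_add[of "i - 1" 1] by (simp add: X_op_def)
  have X_const: "X_op * const_op c = const_op c * X_op" for c
    by (simp add: X_op_def const_op_def fun_op_commute)
  let ?W = "fun_op (Xf powi (i - 1))"
  have "\<theta> * ?W = \<theta> * ?W * X_op * Y"
    by (simp add: mult.assoc XY)
  also have "\<theta> * ?W * X_op = ?W * X_op * (\<theta> + const_op (of_int i))"
    using step2 by (simp add: i mult.assoc)
  also have "\<dots> = ?W * (X_op * (\<theta> + 1) + X_op * const_op (of_int (i - 1)))"
    using const_op_add[of "of_int (i - 1)" 1] by (simp add: distrib_left mult.assoc algebra_simps)
  also have "\<dots> = ?W * (\<theta> + const_op (of_int (i - 1))) * X_op"
    unfolding \<theta>_Xf[symmetric] X_const by (simp add: distrib_left distrib_right mult.assoc)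
  finally show ?case by (simp add: mult.assoc XY)
qed

lemma ev_Xf_powi:
  "ev p * fun_op (Xf powi k) = fun_op (Xf powi k) * ev (pcompose p [:of_int k, 1:])"
proof (induction p)
  case (pCons c p)
  have "ev (pCons c p) * fun_op (Xf powi k)
    = const_op c * fun_op (Xf powi k) + \<theta> * fun_op (Xf powi k) * ev (pcompose p [:of_int k, 1:])"
    by (simp add: distrib_right mult.assoc pCons)
  also have "const_op c * fun_op (Xf powi k) = fun_op (Xf powi k) * const_op c"
    by (simp add: const_op_def fun_op_commute)
  finally show ?case
    by (simp add: \<theta>_Xf_powi pcompose_pCons ev_add ev_mult distrib_left distrib_right mult.assoc
      ev_smult algebra_simps)
qed simp

text \<open>Moving p(\<theta>) past x^j translates its argument by j, so only the left factor is
  translated.\<close>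

lemma gr_mult: "gr i p * gr j q = gr (i + j) (pcompose p [:of_int j, 1:] * q)"
proof -
  have "gr i p * gr j q = fun_op (Xf powi i) * (ev p * fun_op (Xf powi j)) * ev q"
    by (simp add: gr_def mult.assoc)
  then show ?thesis
    by (simp add: ev_Xf_powi gr_def ev_mult fun_op_Xf_powi_add mult.assoc)
qed

lemma gr_add: "gr i (p + q) = gr i p + gr i q"
  by (simp add: gr_def ev_add distrib_left)

lemma gr_0 [simp]: "gr i 0 = 0"
  by (simp add: gr_def)

lemma gr_minus: "gr i (- p) = - gr i p"
  using gr_add[of i p "- p"] by (simp add: eq_neg_iff_add_eq_0 add.commute)

lemma gr_diff: "gr i (p - q) = gr i p - gr i q"
  using gr_add[of i p "- q"] by (simp add: gr_minus)

text \<open>Comparing components in degrees k - 1 to k + 5 gives one hypothesis each. They are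
  stated through values at z, so that explicit instances become plain ring identities. The fourth
  component \<open>fd\<close> makes room for the gauged operators below.\<close>

lemma gr_intertwine:
  assumes "\<And>z. poly fa (z + of_int k) * poly pa z = poly qa (z - 1) * poly ea z"
    and "\<And>z. poly fb (z + of_int k) * poly pa z + poly fa (z + of_int k + 1) * poly pb z
      = poly qa z * poly eb z + poly qb (z - 1) * poly ea z"
    and "\<And>z. poly fc (z + of_int k) * poly pa z + poly fb (z + of_int k + 1) * poly pb z
      + poly fa (z + of_int k + 2) * poly pc z
      = poly qa (z + 1) * poly ec z + poly qb z * poly eb z + poly qc (z - 1) * poly ea z"
    and "\<And>z. poly fd (z + of_int k) * poly pa z + poly fc (z + of_int k + 1) * poly pb z
      + poly fb (z + of_int k + 2) * poly pc z + poly fa (z + of_int k + 3) * poly pd z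
      = poly qb (z + 1) * poly ec z + poly qc z * poly eb z + poly qd (z - 1) * poly ea z"
    and "\<And>z. poly fd (z + of_int k + 1) * poly pb z
      + poly fc (z + of_int k + 2) * poly pc z + poly fb (z + of_int k + 3) * poly pd z
      = poly qc (z + 1) * poly ec z + poly qd z * poly eb z + poly qe (z - 1) * poly ea z"
    and "\<And>z. poly fd (z + of_int k + 2) * poly pc z + poly fc (z + of_int k + 3) * poly pd z
      = poly qd (z + 1) * poly ec z + poly qe z * poly eb z"
    and "\<And>z. poly fd (z + of_int k + 3) * poly pd z = poly qe (z + 1) * poly ec z"
  shows "(gr (- 1) fa + gr 0 fb + gr 1 fc + gr 2 fd)
      * (gr k pa + gr (k + 1) pb + gr (k + 2) pc + gr (k + 3) pd)
    = (gr k qa + gr (k + 1) qb + gr (k + 2) qc + gr (k + 3) qd + gr (k + 4) qe)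
      * (gr (- 1) ea + gr 0 eb + gr 1 ec)"
proof -
  let ?s = "\<lambda>p (j :: int). pcompose p [:of_int j, 1:]"
  have 0: "?s fa k * pa = ?s qa (-1) * ea"
   and 1: "?s fb k * pa + ?s fa (k+1) * pb = qa * eb + ?s qb (-1) * ea"
   and 2: "?s fc k * pa + ?s fb (k+1) * pb + ?s fa (k+2) * pc
      = ?s qa 1 * ec + qb * eb + ?s qc (-1) * ea"
   and 3: "?s fd k * pa + ?s fc (k+1) * pb + ?s fb (k+2) * pc + ?s fa (k+3) * pd
      = ?s qb 1 * ec + qc * eb + ?s qd (-1) * ea"
   and 4: "?s fd (k+1) * pb + ?s fc (k+2) * pc + ?s fb (k+3) * pd
      = ?s qc 1 * ec + qd * eb + ?s qe (-1) * ea"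
   and 5: "?s fd (k+2) * pc + ?s fc (k+3) * pd = ?s qd 1 * ec + qe * eb"
   and 6: "?s fd (k+3) * pd = ?s qe 1 * ec"
    unfolding poly_eq_poly_eq_iff[symmetric] fun_eq_iff
    using assms by (simp_all add: poly_pcompose algebra_simps)
  have "(gr (- 1) fa + gr 0 fb + gr 1 fc + gr 2 fd)
      * (gr k pa + gr (k + 1) pb + gr (k + 2) pc + gr (k + 3) pd)
    = gr (k-1) (?s fa k * pa) + gr k (?s fb k * pa + ?s fa (k+1) * pb)
    + gr (k+1) (?s fc k * pa + ?s fb (k+1) * pb + ?s fa (k+2) * pc)
    + gr (k+2) (?s fd k * pa + ?s fc (k+1) * pb + ?s fb (k+2) * pc + ?s fa (k+3) * pd)
    + gr (k+3) (?s fd (k+1) * pb + ?s fc (k+2) * pc + ?s fb (k+3) * pd)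
    + gr (k+4) (?s fd (k+2) * pc + ?s fc (k+3) * pd)
    + gr (k+5) (?s fd (k+3) * pd)"
    by (simp add: distrib_left distrib_right gr_mult gr_add add_ac)
  also have "\<dots> = (gr k qa + gr (k + 1) qb + gr (k + 2) qc + gr (k + 3) qd + gr (k + 4) qe)
      * (gr (- 1) ea + gr 0 eb + gr 1 ec)"
    unfolding 0 1 2 3 4 5 6
    by (simp add: distrib_left distrib_right gr_mult gr_add add_ac)
  finally show ?thesis .
qed


section \<open>The order of a sum of homogeneous operators\<close>

lemma dcomp_left_linear: "dcomp [:0, f:] q = smult f (dmul q)"
  by (simp add: dcomp_def)

lemma coeffs_of_ev_pCons:
  "coeffs_of (ev (pCons k p)) = [:Fract [:k:] 1:] + smult Xf (dmul (coeffs_of (ev p)))"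
proof -
  have "coeffs_of \<theta> = [:0, Xf:]"
    by (simp add: \<theta>_def X_op_def times_diffop.rep_eq dcomp_def)
  then show ?thesis
    by (simp add: plus_diffop.rep_eq times_diffop.rep_eq const_op_def dcomp_left_linear)
qed

text \<open>\<theta>^n is x^n \<partial>^n plus terms of lower order. Allowing n above the degree
  also yields that the higher coefficients vanish.\<close>

lemma coeff_ev:
  "degree p \<le> n \<Longrightarrow> coeff (coeffs_of (ev p)) n = Xf ^ n * Fract [:coeff p n:] 1"
proof (induction p arbitrary: n)
  case 0
  then show ?case by (simp add: zero_diffop.rep_eq Zero_fract_def[symmetric])
next
  case (pCons k p)
  show ?case
  proof (cases n)
    case 0
    with pCons.prems have "p = 0" by (auto split: if_splits)
    with 0 show ?thesis by (simp add: const_op_def)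
  next
    case (Suc m)
    with pCons.prems have d: "degree p \<le> m" by (auto split: if_splits)
    then have "coeff p (Suc m) = 0" by (simp add: coeff_eq_0)
    \<comment> \<open>The hypothesis one index higher kills the derivative term of
      \<open>coeff_dmul\<close>.\<close>
    with pCons.IH[of "Suc m"] d have "coeff (coeffs_of (ev p)) (Suc m) = 0"
      by (simp add: Zero_fract_def[symmetric])
    with pCons.IH[OF d] show ?thesis
      by (simp add: Suc coeffs_of_ev_pCons coeff_dmul mult.assoc del: ev_pCons)
  qed
qed

lemma coeff_gr:
  "degree p \<le> n \<Longrightarrow> coeff (coeffs_of (gr k p)) n = Xf powi (k + int n) * Fract [:coeff p n:] 1"
  by (simp add: gr_def times_diffop.rep_eq dcomp_def coeff_ev power_int_add Xf_nz)

text \<open>The coefficient of \<partial>^n is x^(k + n) times the polynomial in x formed by the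
  n-th coefficients of \<open>pa\<close> to \<open>pd\<close>. Distinct degrees give distinct powers
  of x, so nothing cancels.\<close>

lemma ord_gr_sum:
  fixes k :: int
  assumes deg: "degree pa \<le> n" "degree pb \<le> n" "degree pc \<le> n" "degree pd \<le> n"
    and nz: "coeff pa n \<noteq> 0"
  defines "P \<equiv> gr k pa + gr (k + 1) pb + gr (k + 2) pc + gr (k + 3) pd"
  shows "P \<noteq> 0" "ord_diffop P = n"
proof -
  have P: "coeff (coeffs_of P) m = Xf powi (k + int m) *
      Fract [:coeff pa m, coeff pb m, coeff pc m, coeff pd m:] 1" if "n \<le> m" for m
  proof -
    have "Xf powi (k + int m + 2) = Xf powi (k + int m) * (Xf * Xf)"
      "Xf powi (k + int m + 3) = Xf powi (k + int m) * (Xf * Xf * Xf)"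
      by (simp_all add: power_int_add Xf_nz power2_eq_square power3_eq_cube)
    moreover have "Xf powi (k + int m + 1) = Xf powi (k + int m) * Xf"
      by (simp add: power_int_add Xf_nz)
    moreover have "k + 1 + int m = k + int m + 1" "k + 2 + int m = k + int m + 2"
      "k + 3 + int m = k + int m + 3"
      by simp_all
    moreover have "degree pa \<le> m" "degree pb \<le> m" "degree pc \<le> m" "degree pd \<le> m"
      using deg that by simp_all
    ultimately have "coeff (coeffs_of P) m = Xf powi (k + int m) * (Fract [:coeff pa m:] 1
       + Xf * Fract [:coeff pb m:] 1 + Xf * Xf * Fract [:coeff pc m:] 1
       + Xf * Xf * Xf * Fract [:coeff pd m:] 1)"
      by (simp only: P_def plus_diffop.rep_eq coeff_add coeff_gr distrib_left mult.assoc)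
    then show ?thesis by simp
  qed
  have "Fract [:coeff pa n, coeff pb n, coeff pc n, coeff pd n:] 1 \<noteq> 0"
    using nz by (simp add: Zero_fract_def eq_fract)
  then have nonzero: "coeff (coeffs_of P) n \<noteq> 0"
    by (subst P) (simp_all add: Xf_nz del: mult_fract)
  then show "P \<noteq> 0"
    by (metis coeff_0 zero_diffop.rep_eq)
  have "coeff (coeffs_of P) m = 0" if "n < m" for m
  proof -
    have "coeff pa m = 0" "coeff pb m = 0" "coeff pc m = 0" "coeff pd m = 0"
      using deg that by (auto intro!: coeff_eq_0)
    with P[of m] that show ?thesis by (simp add: Zero_fract_def[symmetric])
  qed
  then have "degree (coeffs_of P) \<le> n"
    by (intro degree_le) blast
  with nonzero show "ord_diffop P = n"
    unfolding ord_diffop.rep_eq by (intro antisym le_degree)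
qed

section \<open>Intertwining relations for the Dotsenko--Fateev operator\<close>

text \<open>The roots are the local exponents at 0, namely 0, \<open>e1\<close> and
  \<open>e2\<close>.\<close>

definition SE3_low :: "complex \<Rightarrow> complex \<Rightarrow> complex \<Rightarrow> complex \<Rightarrow> complex poly" where
  "SE3_low a b c g = [:0, 1:] * [:- (a + c + 1), 1:] * [:- (2 * a + 2 * c + g + 2), 1:]"

definition SE3_mid :: "complex \<Rightarrow> complex \<Rightarrow> complex \<Rightarrow> complex \<Rightarrow> complex poly" where
  "SE3_mid a b c g =
    (let \<delta> = a + b + c; e1 = a + c + 1; e2 = 2 * a + 2 * c + g + 2; e3 = b + c + 1;
         e4 = 2 * b + 2 * c + g + 2; e5 = - 2 * c; e6 = - \<delta> - c - g - 1; e7 = - 2 * \<delta> - g - 2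
     in [:c * (2 * a + 2 * c + g + 1) * (2 * \<delta> + g + 2),
         - e1 * e2 + (e3 - 1) * (e4 - 1) - e5 * e6 - e6 * e7 - e7 * e5,
         2 * e1 + 2 * e2 + e3 + e4 - 3, - 2:])"

text \<open>The roots \<open>- e5\<close>, \<open>- e6\<close>, \<open>- e7\<close> are the powers
  of x that can lead a solution at infinity.\<close>

definition SE3_high :: "complex \<Rightarrow> complex \<Rightarrow> complex \<Rightarrow> complex \<Rightarrow> complex poly" where
  "SE3_high a b c g = [:- 2 * c, 1:] * [:- (a + b + c) - c - g - 1, 1:] * [:- 2 * (a + b + c) - g - 2, 1:]"

lemma \<theta>_const_left: "\<theta> * (const_op k * D) = const_op k * (\<theta> * D)"
  by (simp add: mult.assoc[symmetric] const_op_commute_\<theta>)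

lemma SE3_gr:
  "SE3 a b c g = gr (- 1) (SE3_low a b c g) + gr 0 (SE3_mid a b c g) + gr 1 (SE3_high a b c g)"
proof -
  have lin: "\<theta> + const_op k = ev [:k, 1:]" for k
    by (simp add: add.commute)
  have partial: "\<partial> = gr (- 1) [:0, 1:]"
  proof -
    have "gr (- 1) [:0, 1:] = fun_op (Xf powi - 1) * fun_op (Xf powi 1) * \<partial>"
      by (simp add: gr_def \<theta>_def X_op_def mult.assoc)
    also have "\<dots> = \<partial>" by (subst fun_op_Xf_powi_add[symmetric]) (simp add: fun_op_1)
    finally show ?thesis ..
  qed
  have ev: "ev p = gr 0 p" for p by (simp add: gr_def fun_op_1)
  have quad: "(\<theta> + const_op (- e1 + 1)) * (\<theta> + const_op (- e2 + 1))
     = ev ([:- e1 + 1, 1:] * [:- e2 + 1, 1:])" for e1 e2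
    by (simp only: lin ev_mult)
  \<comment> \<open>Moving the factor x^-1 of \<partial> = x^-1 \<theta> to the left lowers the
    argument of both factors by 1, which absorbs their \<open>+ 1\<close>.\<close>
  have low: "(\<theta> + const_op (- e1 + 1)) * (\<theta> + const_op (- e2 + 1)) * \<partial>
      = gr (- 1) ([:0, 1:] * [:- e1, 1:] * [:- e2, 1:])" for e1 e2
    unfolding quad partial ev gr_mult by (simp add: pcompose_pCons algebra_simps)
  have high: "X_op * ((\<theta> + const_op e5) * (\<theta> + const_op e6) * (\<theta> + const_op e7))
      = gr 1 ([:e5, 1:] * [:e6, 1:] * [:e7, 1:])" for e5 e6 e7
    unfolding lin ev_mult[symmetric] gr_def by (simp add: X_op_def)
  \<comment> \<open>The \<open>- 2\<close> in \<open>SE3\<close> is a numeral of the operator ring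
    and has to be recognised as a constant operator.\<close>
  have "- 2 = const_op (- 2)"
    using const_op_add[of 1 1] by (simp add: const_op_minus)
  then have mid: "- 2 * \<theta> ^ 3 + const_op k2 * \<theta> ^ 2 + const_op k1 * \<theta> + const_op k0
     = gr 0 [:k0, k1, k2, - 2:]" for k0 k1 k2
    by (simp only: gr_def power_int_0_right fun_op_1 ev_pCons ev_0 mult_zero_right mult_1_left add_0_left add_0_right
      power3_eq_cube power2_eq_square distrib_left mult.assoc const_op_commute_\<theta>
      \<theta>_const_left add_ac)
  show ?thesis
    unfolding SE3_def Let_def low high mid SE3_low_def SE3_mid_def SE3_high_def
    by (simp only: add_ac)
qed


text \<open>The coefficient of \<partial>^3 is x^2 (x - 1)^2 for all parameters.\<close>

lemma ord_SE3: "ord_diffop (SE3 a b c g) = 3"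
proof -
  have "degree (SE3_low a b c g) \<le> 3" "degree (SE3_mid a b c g) \<le> 3"
    "degree (SE3_high a b c g) \<le> 3" "coeff (SE3_low a b c g) 3 \<noteq> 0"
    by (simp_all add: SE3_low_def SE3_mid_def SE3_high_def Let_def eval_nat_numeral)
  from ord_gr_sum(2)[where k = "- 1" and n = 3 and pd = 0, OF this(1-3) _ this(4)]
  show ?thesis by (simp add: SE3_gr)
qed

text \<open>The case without a pole at 1: P and Q live in degrees k to k + 2, which leaves five
  identities.\<close>

lemma admits_shift_operatorI:
  fixes k :: int
  assumes deg: "degree pa \<le> 2" "degree pb \<le> 2" "degree pc \<le> 2" "coeff pa 2 \<noteq> 0"
    and "\<And>z. poly (SE3_low a' b' c' g') (z + of_int k) * poly pa z
      = poly qa (z - 1) * poly (SE3_low a b c g) z"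
    and "\<And>z. poly (SE3_mid a' b' c' g') (z + of_int k) * poly pa z
        + poly (SE3_low a' b' c' g') (z + of_int k + 1) * poly pb z
      = poly qa z * poly (SE3_mid a b c g) z + poly qb (z - 1) * poly (SE3_low a b c g) z"
    and "\<And>z. poly (SE3_high a' b' c' g') (z + of_int k) * poly pa z
        + poly (SE3_mid a' b' c' g') (z + of_int k + 1) * poly pb z
        + poly (SE3_low a' b' c' g') (z + of_int k + 2) * poly pc z
      = poly qa (z + 1) * poly (SE3_high a b c g) z + poly qb z * poly (SE3_mid a b c g) z
        + poly qc (z - 1) * poly (SE3_low a b c g) z"
    and "\<And>z. poly (SE3_high a' b' c' g') (z + of_int k + 1) * poly pb z
        + poly (SE3_mid a' b' c' g') (z + of_int k + 2) * poly pc z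
      = poly qb (z + 1) * poly (SE3_high a b c g) z + poly qc z * poly (SE3_mid a b c g) z"
    and "\<And>z. poly (SE3_high a' b' c' g') (z + of_int k + 2) * poly pc z
      = poly qc (z + 1) * poly (SE3_high a b c g) z"
  shows "admits_shift_operator (SE3 a b c g) (SE3 a' b' c' g')"
proof -
  have "SE3 a' b' c' g' * (gr k pa + gr (k + 1) pb + gr (k + 2) pc)
    = (gr k qa + gr (k + 1) qb + gr (k + 2) qc) * SE3 a b c g"
    using gr_intertwine[where fd = 0 and pd = 0 and qd = 0 and qe = 0, OF assms(5-7)] assms(8,9)
    by (simp add: SE3_gr)
  then show ?thesis
    using ord_gr_sum[where k = k and n = 2 and pd = 0, OF deg(1-3) _ deg(4)]
    unfolding admits_shift_operator_def shift_operator_def by (auto simp: ord_SE3)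
qed

section \<open>Operators with a simple pole at x = 1\<close>

text \<open>
  Up to the lowest one, which is \<open>- SE3_low\<close>, these are the components of the operator
  $(x-1)^2 E (x-1)^{-1}$, in which the power of $x - 1$ in front is just large enough to clear
  the denominators.
\<close>

definition gauged_0 :: "complex \<Rightarrow> complex \<Rightarrow> complex \<Rightarrow> complex \<Rightarrow> complex poly" where
  "gauged_0 a b c g = 2 * SE3_low a b c g - pcompose (SE3_low a b c g) [:1, 1:] - SE3_mid a b c g"

definition gauged_1 :: "complex \<Rightarrow> complex \<Rightarrow> complex \<Rightarrow> complex \<Rightarrow> complex poly" where
  "gauged_1 a b c g = pcompose (SE3_high a b c g) [:- 2, 1:] - 2 * pcompose (SE3_high a b c g) [:- 1, 1:]
     + pcompose (SE3_mid a b c g) [:- 1, 1:]"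

definition gauged_2 :: "complex \<Rightarrow> complex \<Rightarrow> complex \<Rightarrow> complex \<Rightarrow> complex poly" where
  "gauged_2 a b c g = pcompose (SE3_high a b c g) [:- 1, 1:]"

lemma X_minus_1_gr: "(X_op - 1) * gr i p = gr (i + 1) p - gr i p"
proof -
  have "X_op * gr i p = gr (i + 1) p"
    using fun_op_Xf_powi_add[of 1 i] by (simp add: gr_def X_op_def mult.assoc add.commute)
  then show ?thesis by (simp add: left_diff_distrib)
qed

lemma gr_X_minus_1: "gr i p * (X_op - 1) = gr (i + 1) (pcompose p [:1, 1:]) - gr i p"
proof -
  have "gr 1 1 = X_op"
    by (simp add: gr_def X_op_def one_pCons)
  then have "gr i p * X_op = gr (i + 1) (pcompose p [:1, 1:])"
    using gr_mult[of i p 1 1] by simp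
  then show ?thesis by (simp add: right_diff_distrib)
qed

lemma gauge_SE3:
  "(X_op - 1) * (X_op - 1) * SE3 a b c g = (gr (- 1) (- SE3_low a b c g)
     + gr 0 (gauged_0 a b c g) + gr 1 (gauged_1 a b c g) + gr 2 (gauged_2 a b c g)) * (X_op - 1)"
proof -
  let ?l = "SE3_low a b c g" and ?m = "SE3_mid a b c g" and ?h = "SE3_high a b c g"
  let ?s = "\<lambda>p. pcompose p [:1, 1:]"
  \<comment> \<open>These are the conditions for dividing (x - 1)^2 E by x - 1 on the right.
    \<open>0\<close>, \<open>2\<close> and \<open>3\<close> read off the quotient from both ends;
    \<open>1\<close> says that no remainder is left, and only there do the coefficients of
    \<open>SE3\<close> enter.\<close>
  have 0: "?m - 2 * ?l = ?s (- ?l) - gauged_0 a b c g"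
    and 1: "?h - 2 * ?m + ?l = ?s (gauged_0 a b c g) - gauged_1 a b c g"
    and 2: "?m - 2 * ?h = ?s (gauged_1 a b c g) - gauged_2 a b c g"
    and 3: "?h = ?s (gauged_2 a b c g)"
    unfolding poly_eq_poly_eq_iff[symmetric] fun_eq_iff gauged_0_def gauged_1_def gauged_2_def
       apply (simp add: poly_pcompose algebra_simps)
      apply (simp add: poly_pcompose SE3_low_def SE3_mid_def SE3_high_def Let_def, algebra)
     apply (simp_all add: poly_pcompose algebra_simps)
    done
  have square: "(X_op - 1) * (X_op - 1) * gr i p
      = gr (i + 1 + 1) p - gr (i + 1) p - (gr (i + 1) p - gr i p)" for i p
    by (simp only: mult.assoc X_minus_1_gr right_diff_distrib[of "X_op - 1" "gr (i + 1) p" "gr i p"])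
  have "(X_op - 1) * (X_op - 1) * SE3 a b c g = gr (- 1) ?l + gr 0 (?m - 2 * ?l)
    + gr 1 (?h - 2 * ?m + ?l) + gr 2 (?m - 2 * ?h) + gr 3 ?h"
    unfolding SE3_gr distrib_left square gr_add gr_diff mult_2 by simp
  also have "\<dots> = (gr (- 1) (- ?l)
     + gr 0 (gauged_0 a b c g) + gr 1 (gauged_1 a b c g) + gr 2 (gauged_2 a b c g)) * (X_op - 1)"
    unfolding 0 1 2 using arg_cong[OF 3, of "gr 3"]
    by (simp add: distrib_right left_diff_distrib gr_X_minus_1 gr_diff gr_minus pcompose_uminus)
  finally show ?thesis .
qed

text \<open>Put P = (x - 1)^-1 R. Since E' (x - 1)^-1 = (x - 1)^-2 F with F the gauged operator, F R
  = Q E gives E' P = (x - 1)^-2 Q E.\<close>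

lemma admits_shift_operatorI_gauged:
  fixes k :: int
  assumes deg: "degree pa \<le> 2" "degree pb \<le> 2" "degree pc \<le> 2" "degree pd \<le> 2" "coeff pa 2 \<noteq> 0"
    and "\<And>z. poly (- SE3_low a' b' c' g') (z + of_int k) * poly pa z
      = poly qa (z - 1) * poly (SE3_low a b c g) z"
    and "\<And>z. poly (gauged_0 a' b' c' g') (z + of_int k) * poly pa z
        + poly (- SE3_low a' b' c' g') (z + of_int k + 1) * poly pb z
      = poly qa z * poly (SE3_mid a b c g) z + poly qb (z - 1) * poly (SE3_low a b c g) z"
    and "\<And>z. poly (gauged_1 a' b' c' g') (z + of_int k) * poly pa z
        + poly (gauged_0 a' b' c' g') (z + of_int k + 1) * poly pb z
        + poly (- SE3_low a' b' c' g') (z + of_int k + 2) * poly pc z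
      = poly qa (z + 1) * poly (SE3_high a b c g) z + poly qb z * poly (SE3_mid a b c g) z
        + poly qc (z - 1) * poly (SE3_low a b c g) z"
    and "\<And>z. poly (gauged_2 a' b' c' g') (z + of_int k) * poly pa z
        + poly (gauged_1 a' b' c' g') (z + of_int k + 1) * poly pb z
        + poly (gauged_0 a' b' c' g') (z + of_int k + 2) * poly pc z
        + poly (- SE3_low a' b' c' g') (z + of_int k + 3) * poly pd z
      = poly qb (z + 1) * poly (SE3_high a b c g) z + poly qc z * poly (SE3_mid a b c g) z
        + poly qd (z - 1) * poly (SE3_low a b c g) z"
    and "\<And>z. poly (gauged_2 a' b' c' g') (z + of_int k + 1) * poly pb z
        + poly (gauged_1 a' b' c' g') (z + of_int k + 2) * poly pc z
        + poly (gauged_0 a' b' c' g') (z + of_int k + 3) * poly pd z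
      = poly qc (z + 1) * poly (SE3_high a b c g) z + poly qd z * poly (SE3_mid a b c g) z
        + poly qe (z - 1) * poly (SE3_low a b c g) z"
    and "\<And>z. poly (gauged_2 a' b' c' g') (z + of_int k + 2) * poly pc z
        + poly (gauged_1 a' b' c' g') (z + of_int k + 3) * poly pd z
      = poly qd (z + 1) * poly (SE3_high a b c g) z + poly qe z * poly (SE3_mid a b c g) z"
    and "\<And>z. poly (gauged_2 a' b' c' g') (z + of_int k + 3) * poly pd z
      = poly qe (z + 1) * poly (SE3_high a b c g) z"
  shows "admits_shift_operator (SE3 a b c g) (SE3 a' b' c' g')"
proof -
  define f where "f = inverse (Xf - 1)"
  have "Xf - 1 \<noteq> 0" by (simp add: One_fract_def Zero_fract_def eq_fract one_pCons)
  moreover have X: "X_op - 1 = fun_op (Xf - 1)"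
    using fun_op_add[of "Xf - 1" 1] by (simp add: X_op_def fun_op_1)
  ultimately have inv: "fun_op f * (X_op - 1) = 1" "(X_op - 1) * fun_op f = 1" and f: "f \<noteq> 0"
    by (simp_all add: f_def fun_op_mult[symmetric] fun_op_1)
  define R where "R = gr k pa + gr (k + 1) pb + gr (k + 2) pc + gr (k + 3) pd"
  define Q where "Q = gr k qa + gr (k + 1) qb + gr (k + 2) qc + gr (k + 3) qd + gr (k + 4) qe"
  define F where "F = gr (- 1) (- SE3_low a' b' c' g') + gr 0 (gauged_0 a' b' c' g')
    + gr 1 (gauged_1 a' b' c' g') + gr 2 (gauged_2 a' b' c' g')"
  have FR: "F * R = Q * SE3 a b c g"
    unfolding F_def R_def Q_def SE3_gr by (rule gr_intertwine) (fact assms(6-12))+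
  have "SE3 a' b' c' g' * fun_op f
      = fun_op f * (fun_op f * (X_op - 1)) * (X_op - 1) * SE3 a' b' c' g' * fun_op f"
    by (simp add: inv)
  also have "\<dots> = fun_op f * fun_op f * ((X_op - 1) * (X_op - 1) * SE3 a' b' c' g') * fun_op f"
    by (simp only: mult.assoc)
  also have "\<dots> = fun_op f * fun_op f * F * ((X_op - 1) * fun_op f)"
    unfolding gauge_SE3 F_def by (simp only: mult.assoc)
  finally have "SE3 a' b' c' g' * (fun_op f * R) = (fun_op f * fun_op f * Q) * SE3 a b c g"
    using FR by (simp add: inv mult.assoc[symmetric]) (simp add: mult.assoc)
  \<comment> \<open>Left multiplication by a nonzero function preserves the order.\<close>
  moreover have "coeffs_of (fun_op f * R) = smult f (coeffs_of R)"
    by (simp add: times_diffop.rep_eq dcomp_def)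
  moreover have "R \<noteq> 0" "ord_diffop R = 2"
    unfolding R_def using ord_gr_sum[OF deg] by simp_all
  ultimately have "shift_operator (SE3 a b c g) (SE3 a' b' c' g') (fun_op f * R)"
    using f unfolding shift_operator_def ord_SE3
    by (auto simp: ord_diffop.rep_eq coeffs_of_inject[symmetric] zero_diffop.rep_eq)
  then show ?thesis
    unfolding admits_shift_operator_def by blast
qed

section \<open>The shift operators\<close>

lemmas SE3_defs = SE3_low_def SE3_mid_def SE3_high_def Let_def
lemmas gauged_defs = gauged_0_def gauged_1_def gauged_2_def

text \<open>By the lowest identity \<open>pa\<close> vanishes at every exponent s at 0 for which s +
  k is not an exponent after the shift. Here \<open>e1\<close> and \<open>e2\<close> move by 1 and
  2, so for k = 0 they are the roots of \<open>pa\<close>. Likewise \<open>pc\<close>, of degree 2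
  in x, vanishes at those powers at infinity that do not move by 2.\<close>

lemma SE3_shift_a_plus: "admits_shift_operator (SE3 a b c g) (SE3 (a + 1) b c g)"
  by (rule admits_shift_operatorI[where k = "0"
      and pa = "[:- a - c - 1, 1:] * [:- 2 * a - 2 * c - g - 2, 1:]"
      and pb = "[:- c * (6 * a + 2 * b + 6 * c + 3 * g + 6), 4 * a + b + 7 * c + 2 * g + 4,
            - 2:]"
      and pc = "[:- 2 * c, 1:] * [:- a - b - 2 * c - g - 1, 1:]"
      and qa = "[:- a - c - 1, 1:] * [:- 2 * a - 2 * c - g - 3, 1:]"
      and qb = "[:- 6 * a * c - 2 * b * c - 6 * c^2 - 3 * c * g + 2 * a - 6 * c + g + 2, 4 * a
            + b + 7 * c + 2 * g + 4, - 2:]"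
      and qc = "[:- 2 * c + 1, 1:] * [:- a - b - 2 * c - g - 1, 1:]"];
    simp add: eval_nat_numeral SE3_defs; algebra?)

text \<open>Now \<open>e2\<close> drops by 2, which k = - 2 matches; the other exponents, 0 and
  \<open>e1\<close>, are the roots of \<open>pa\<close>. The highest degree 0 matches the fixed
  power 2c at infinity, and \<open>pc\<close> vanishes at the other two.\<close>

lemma SE3_shift_a_minus: "admits_shift_operator (SE3 a b c g) (SE3 (a - 1) b c g)"
  by (rule admits_shift_operatorI[where k = "- 2"
      and pa = "[:0, 1:] * [:- a - c - 1, 1:]"
      and pb = "[:- c * (2 * a + 2 * b + 2 * c + g + 2), 4 * a + 3 * b + 5 * c + 2 * g + 4,
            - 2:]"
      and pc = "[:- a - b - 2 * c - g - 1, 1:] * [:- 2 * a - 2 * b - 2 * c - g - 2, 1:]"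
      and qa = "[:- 1, 1:] * [:- a - c - 1, 1:]"
      and qb = "[:- (c + 1) * (2 * a + 2 * b + 2 * c + g + 2), 4 * a + 3 * b + 5 * c + 2 * g
            + 4, - 2:]"
      and qc = "[:- a - b - 2 * c - g - 1, 1:] * [:- 2 * a - 2 * b - 2 * c - g - 1, 1:]"];
    simp add: eval_nat_numeral SE3_defs; algebra?)

text \<open>The exponents at 0 do not involve b, so the lowest identity only says that
  \<open>qa\<close> is \<open>pa\<close> translated by 1; \<open>pa\<close> is determined by the
  other identities.\<close>

lemma SE3_shift_b_plus: "admits_shift_operator (SE3 a b c g) (SE3 a (b + 1) c g)"
  by (rule admits_shift_operatorI[where k = "0"
      and pa = "[:(b + 1) * (2 * b + g + 2), - (a - 2 * b + c - 1), 1:]"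
      and pb = "[:- c * (2 * a - 2 * b + 2 * c + g - 2), 2 * a - b + 5 * c + g, - 2:]"
      and pc = "[:- 2 * c, 1:] * [:- a - b - 2 * c - g - 1, 1:]"
      and qa = "[:2 * b^2 + b * g - a + 6 * b - c + g + 4, - (a - 2 * b + c - 3), 1:]"
      and qb = "[:- 2 * a * c + 2 * b * c - 2 * c^2 - c * g + 2 * a + 6 * c + g, 2 * a - b
            + 5 * c + g - 3, - 2:]"
      and qc = "[:- 2 * c + 1, 1:] * [:- a - b - 2 * c - g - 1, 1:]"];
    simp add: eval_nat_numeral SE3_defs; algebra?)

text \<open>Division by x - 1 turns the degrees 0 and 1 into highest degree 0 at infinity. This
  matches the fixed power 2c, and \<open>pb\<close> vanishes at the other two. The coefficient of
  \<partial>^2 before division is x^2 (1 - x), so a pole can only occur in lower order.\<close>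

lemma SE3_shift_b_minus: "admits_shift_operator (SE3 a b c g) (SE3 a (b - 1) c g)"
  by (rule admits_shift_operatorI_gauged[where k = "0"
      and pa = "[:(a + b + c + g + 1) * (2 * a + 2 * b + 2 * c + g + 2), - (3 * a + 2 * b
            + 3 * c + 2 * g + 3), 1:]"
      and pb = "smult (- 1) ([:- a - b - 2 * c - g - 1, 1:] * [:- 2 * a - 2 * b - 2 * c - g - 2,
            1:])"
      and pc = "0"
      and pd = "0"
      and qa = "[:- 2 * a^2 - 4 * a * b - 4 * a * c - 3 * a * g - 2 * b^2 - 4 * b * c
            - 3 * b * g - 2 * c^2 - 3 * c * g - g^2 - a - 2 * b - c - g, 3 * a + 2 * b
            + 3 * c + 2 * g + 1, - 1:]"
      and qb = "[:4 * a^2 + 8 * a * b + 10 * a * c + 6 * a * g + 4 * b^2 + 10 * b * c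
            + 6 * b * g + 6 * c^2 + 7 * c * g + 2 * g^2 + 4 * a + 4 * b + 4 * c + 3 * g,
            - 6 * a - 5 * b - 7 * c - 4 * g - 3, 2:]"
      and qc = "smult (- 1) ([:- a - b - 2 * c - g - 1, 1:] * [:- 2 * a - 2 * b - 2 * c - g - 1,
            1:])"
      and qd = "0"
      and qe = "0"];
    simp add: eval_nat_numeral gauged_defs SE3_defs poly_pcompose; algebra?)

text \<open>At 0 the exponents move as for a. At infinity all three powers grow by 2, the highest
  degree, so the highest identity only ties \<open>qc\<close> to a translate of
  \<open>pc\<close>.\<close>

lemma SE3_shift_c_plus: "admits_shift_operator (SE3 a b c g) (SE3 a b (c + 1) g)"
  by (rule admits_shift_operatorI[where k = "0"
      and pa = "[:- a - c - 1, 1:] * [:- 2 * a - 2 * c - g - 2, 1:]"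
      and pb = "[:- 4 * a^2 - 4 * a * b - 14 * a * c - 4 * a * g - 6 * b * c - 2 * b * g
            - 10 * c^2 - 7 * c * g - g^2 - 12 * a - 4 * b - 18 * c - 6 * g - 8, 6 * a
            + 3 * b + 9 * c + 3 * g + 8, - 2:]"
      and pc = "[:2 * a^2 + 4 * a * b + 10 * a * c + 3 * a * g + 2 * b^2 + 10 * b * c
            + 3 * b * g + 10 * c^2 + 7 * c * g + g^2 + 8 * a + 8 * b + 18 * c + 6 * g + 8,
            - 3 * a - 3 * b - 6 * c - 2 * g - 5, 1:]"
      and qa = "[:- a - c - 1, 1:] * [:- 2 * a - 2 * c - g - 3, 1:]"
      and qb = "[:- 4 * a^2 - 4 * a * b - 14 * a * c - 4 * a * g - 6 * b * c - 2 * b * g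
            - 10 * c^2 - 7 * c * g - g^2 - 16 * a - 6 * b - 24 * c - 8 * g - 14, 6 * a
            + 3 * b + 9 * c + 3 * g + 11, - 2:]"
      and qc = "[:2 * a^2 + 4 * a * b + 10 * a * c + 3 * a * g + 2 * b^2 + 10 * b * c
            + 3 * b * g + 10 * c^2 + 7 * c * g + g^2 + 11 * a + 11 * b + 24 * c + 8 * g
            + 14, - 3 * a - 3 * b - 6 * c - 2 * g - 7, 1:]"];
    simp add: eval_nat_numeral SE3_defs; algebra?)

text \<open>At infinity all three powers drop by 2, and - 2 is also the highest degree after
  division by x - 1; \<open>pb\<close> therefore has no prescribed roots.\<close>

lemma SE3_shift_c_minus: "admits_shift_operator (SE3 a b c g) (SE3 a b (c - 1) g)"
  by (rule admits_shift_operatorI_gauged[where k = "- 2"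
      and pa = "[:0, 1:] * [:- a - c - 1, 1:]"
      and pb = "[:- c * (2 * a + 2 * b + 2 * c + g + 2), a + b + 2 * c + 1, - 1:]"
      and pc = "0"
      and pd = "0"
      and qa = "smult (- 1) ([:- 1, 1:] * [:- a - c - 1, 1:])"
      and qb = "[:2 * a * c + 2 * b * c + 2 * c^2 + c * g + 2 * a + 4 * c + 2, - (2 * a + b
            + 3 * c + 5), 2:]"
      and qc = "[:- 2 * a * c - 2 * b * c - 2 * c^2 - c * g - a - b - 4 * c - 2, a + b + 2 * c
            + 3, - 1:]"
      and qd = "0"
      and qe = "0"];
    simp add: eval_nat_numeral gauged_defs SE3_defs poly_pcompose; algebra?)

text \<open>Only \<open>e2\<close> moves at 0, so \<open>pa\<close> is z - \<open>e2\<close> times a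
  linear factor. The assumption says that its leading coefficient is nonzero, which secures order 2.
  At infinity only 2c stays fixed, and \<open>pc\<close> vanishes there.\<close>

lemma SE3_shift_g_plus:
  assumes "2 * a + 2 * b + 2 * c + 3 * g + 6 \<noteq> 0"
  shows "admits_shift_operator (SE3 a b c g) (SE3 a b c (g + 2))"
  by (rule admits_shift_operatorI[where k = "0"
      and pa = "[:- (g + 1) * (2 * b + g + 2) * (2 * a + 2 * c + g + 2), - 4 * a^2 - 4 * a * b
            - 8 * a * c - 8 * a * g - 4 * b * c - 4 * c^2 - 8 * c * g - 2 * g^2 - 16 * a
            - 2 * b - 16 * c - 9 * g - 10, 2 * a + 2 * b + 2 * c + 3 * g + 6:]"
      and pb = "[:- 2 * c * (4 * a^2 + 8 * a * b + 8 * a * c + 10 * a * g + 4 * b^2 + 8 * b * c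
            + 6 * b * g + 4 * c^2 + 10 * c * g + 4 * g^2 + 18 * a + 14 * b + 18 * c + 15 * g
            + 14), 8 * a^2 + 12 * a * b + 20 * a * c + 16 * a * g + 4 * b^2 + 16 * b * c
            + 8 * b * g + 12 * c^2 + 24 * c * g + 6 * g^2 + 32 * a + 18 * b + 46 * c
            + 24 * g + 24, - 2 * (2 * a + 2 * b + 2 * c + 3 * g + 6):]"
      and pc = "[:2 * c * (4 * a^2 + 8 * a * b + 8 * a * c + 8 * a * g + 4 * b^2 + 8 * b * c
            + 8 * b * g + 4 * c^2 + 10 * c * g + 4 * g^2 + 16 * a + 16 * b + 18 * c + 15 * g
            + 14), - 4 * a^2 - 8 * a * b - 12 * a * c - 8 * a * g - 4 * b^2 - 12 * b * c
            - 8 * b * g - 8 * c^2 - 16 * c * g - 4 * g^2 - 16 * a - 16 * b - 30 * c - 15 * g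
            - 14, 2 * a + 2 * b + 2 * c + 3 * g + 6:]"
      and qa = "[:- (2 * a + 2 * c + g + 3) * (2 * b * g + g^2 + 2 * a + 4 * b + 2 * c + 6 * g
            + 8), - 4 * a^2 - 4 * a * b - 8 * a * c - 8 * a * g - 4 * b * c - 4 * c^2
            - 8 * c * g - 2 * g^2 - 16 * a - 2 * b - 16 * c - 9 * g - 10, 2 * a + 2 * b
            + 2 * c + 3 * g + 6:]"
      and qb = "[:- 8 * a^2 * c - 16 * a * b * c - 16 * a * c^2 - 20 * a * c * g - 8 * b^2 * c
            - 16 * b * c^2 - 12 * b * c * g - 8 * c^3 - 20 * c^2 * g - 8 * c * g^2 + 8 * a^2
            + 8 * a * b - 28 * a * c + 12 * a * g - 28 * b * c + 4 * b * g - 36 * c^2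
            - 26 * c * g + 4 * g^2 + 28 * a + 8 * b - 20 * c + 18 * g + 20, 8 * a^2
            + 12 * a * b + 20 * a * c + 16 * a * g + 4 * b^2 + 16 * b * c + 8 * b * g
            + 12 * c^2 + 24 * c * g + 6 * g^2 + 32 * a + 18 * b + 46 * c + 24 * g + 24,
            - 2 * (2 * a + 2 * b + 2 * c + 3 * g + 6):]"
      and qc = "[:2 * (2 * c - 1) * (2 * a^2 + 4 * a * b + 4 * a * c + 4 * a * g + 2 * b^2
            + 4 * b * c + 4 * b * g + 2 * c^2 + 5 * c * g + 2 * g^2 + 9 * a + 9 * b + 10 * c
            + 9 * g + 10), - 4 * a^2 - 8 * a * b - 12 * a * c - 8 * a * g - 4 * b^2
            - 12 * b * c - 8 * b * g - 8 * c^2 - 16 * c * g - 4 * g^2 - 16 * a - 16 * b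
            - 30 * c - 15 * g - 14, 2 * a + 2 * b + 2 * c + 3 * g + 6:]"];
    simp add: assms eval_nat_numeral SE3_defs; algebra?)

text \<open>The two assumptions are the factors of the leading coefficient of \<open>pa\<close>,
  whose roots are the fixed exponents 0 and \<open>e1\<close>. The two powers that drop by 2 at
  infinity are the roots of \<open>pd\<close>.\<close>

lemma SE3_shift_g_minus:
  assumes "a + c + g \<noteq> 0" "2 * b + g \<noteq> 0"
  shows "admits_shift_operator (SE3 a b c g) (SE3 a b c (g - 2))"
  by (rule admits_shift_operatorI_gauged[where k = "- 2"
      and pa = "smult ((2 * b + g) * (a + c + g)) ([:0, 1:] * [:- a - c - 1, 1:])"
      and pb = "[:- c * (2 * b + g) * (a + c + g) * (2 * a + 2 * b + 2 * c + g + 2), (2 * b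
            + g) * (a^2 + a * b + 7 * a * c + 3 * a * g + 3 * b * c + 2 * b * g + 6 * c^2
            + 6 * c * g + g^2 + a + 5 * c + 3 * g), - (2 * b + g) * (a + 3 * c + 2 * g):]"
      and pc = "[:(2 * c + g) * (2 * a + 2 * b + 2 * c + g + 2) * (a^2 + 2 * a * b + a * c
            + 2 * a * g + b^2 + 3 * b * c + 2 * b * g + 2 * c * g + g^2 + a + b + g),
            - (2 * c + g) * (3 * a^2 + 9 * a * b + 3 * a * c + 7 * a * g + 6 * b^2
            + 9 * b * c + 8 * b * g + 6 * c * g + 3 * g^2 + 3 * a + 7 * b + 5 * g), (2 * c
            + g) * (a + 3 * b + 2 * g):]"
      and pd = "smult (- (2 * c + g) * (a + b + g)) ([:- a - b - 2 * c - g - 1, 1:] * [:- 2 * a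
            - 2 * b - 2 * c - g - 2, 1:])"
      and qa = "smult (- (2 * b + g) * (a + c + g)) ([:- 1, 1:] * [:- a - c - 2, 1:])"
      and qb = "[:(2 * b + g) * (a + c + g) * (2 * a * c + 2 * b * c + 2 * c^2 + c * g + 4 * a
            + 2 * b + 6 * c + g + 6), - (2 * b + g) * (2 * a^2 + a * b + 9 * a * c
            + 4 * a * g + 3 * b * c + 2 * b * g + 7 * c^2 + 7 * c * g + g^2 + 8 * a + 10 * c
            + 9 * g), (2 * b + g) * (2 * a + 4 * c + 3 * g):]"
      and qc = "[:- 4 * a^3 * c - 2 * a^3 * g - 16 * a^2 * b * c - 6 * a^2 * b * g
            - 8 * a^2 * c^2 - 16 * a^2 * c * g - 5 * a^2 * g^2 - 16 * a * b^2 * c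
            - 6 * a * b^2 * g - 32 * a * b * c^2 - 40 * a * b * c * g - 10 * a * b * g^2
            - 4 * a * c^3 - 24 * a * c^2 * g - 20 * a * c * g^2 - 4 * a * g^3 - 4 * b^3 * c
            - 2 * b^3 * g - 20 * b^2 * c^2 - 22 * b^2 * c * g - 5 * b^2 * g^2 - 16 * b * c^3
            - 36 * b * c^2 * g - 23 * b * c * g^2 - 4 * b * g^3 - 10 * c^3 * g
            - 15 * c^2 * g^2 - 7 * c * g^3 - g^4 - 6 * a^2 * b + 2 * a^2 * c - 2 * a^2 * g
            - 6 * a * b^2 - 24 * a * b * c - 14 * a * b * g + 2 * a * c^2 - 10 * a * c * g
            - 5 * a * g^2 - 10 * b^2 * c - 8 * b^2 * g - 22 * b * c^2 - 28 * b * c * g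
            - 8 * b * g^2 - 10 * c^2 * g - 11 * c * g^2 - 2 * g^3 - 12 * a * b - 6 * a * g
            - 12 * b * c - 12 * b * g - 6 * c * g - 6 * g^2, 2 * a^2 * b + 6 * a^2 * c
            + 4 * a^2 * g + 2 * a * b^2 + 32 * a * b * c + 16 * a * b * g + 6 * a * c^2
            + 24 * a * c * g + 10 * a * g^2 + 18 * b^2 * c + 10 * b^2 * g + 30 * b * c^2
            + 40 * b * c * g + 12 * b * g^2 + 18 * c^2 * g + 18 * c * g^2 + 4 * g^3
            + 10 * a * b - 2 * a * c + 4 * a * g + 24 * b * c + 17 * b * g + 11 * c * g
            + 8 * g^2, - 2 * a * b - 2 * a * c - 2 * a * g - 12 * b * c - 7 * b * g
            - 7 * c * g - 4 * g^2:]"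
      and qd = "[:(2 * c + g) * (4 * a^3 + 12 * a^2 * b + 10 * a^2 * c + 10 * a^2 * g
            + 12 * a * b^2 + 24 * a * b * c + 20 * a * b * g + 6 * a * c^2 + 19 * a * c * g
            + 8 * a * g^2 + 4 * b^3 + 14 * b^2 * c + 10 * b^2 * g + 10 * b * c^2
            + 21 * b * c * g + 8 * b * g^2 + 8 * c^2 * g + 8 * c * g^2 + 2 * g^3 + 4 * a * b
            + 3 * a * g + 4 * b^2 + 8 * b * c + 5 * b * g + 4 * c * g + 2 * g^2 - 2 * a
            + 2 * b), - (2 * c + g) * (6 * a^2 + 15 * a * b + 7 * a * c + 12 * a * g
            + 9 * b^2 + 13 * b * c + 13 * b * g + 10 * c * g + 5 * g^2 + 6 * b + 3 * g),
            (2 * c + g) * (2 * a + 4 * b + 3 * g):]"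
      and qe = "smult (- (2 * c + g) * (a + b + g)) ([:- a - b - 2 * c - g, 1:] * [:- 2 * a
            - 2 * b - 2 * c - g - 1, 1:])"];
    simp add: assms eval_nat_numeral gauged_defs SE3_defs poly_pcompose; algebra?)

section \<open>The exceptional parameters\<close>

lemma ex_poly4_exceptional: "\<exists>F. F \<noteq> 0 \<and> (\<forall>a b c g. poly4 F a b c g =
   (2 * a + 2 * b + 2 * c + 3 * g + 6) * (a + c + g) * (2 * b + g))"
proof -
  \<comment> \<open>\<open>lin u v w x y\<close> encodes u a + v b + w c + x g + y, with a as the
    outermost variable. A product of three such forms gathers all exceptional parameters in one zero
    set.\<close>
  define lin :: "complex \<Rightarrow> complex \<Rightarrow> complex \<Rightarrow> complex \<Rightarrow> complex \<Rightarrow> complex poly poly poly poly"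
    where "lin u v w x y = [:[:[:[:y, x:], [:w:]:], [:[:v:]:]:], [:[:[:u:]:]:]:]" for u v w x y
  have "poly4 (lin 2 2 2 3 6 * lin 1 0 1 1 0 * lin 0 2 0 1 0) a b c g
    = (2 * a + 2 * b + 2 * c + 3 * g + 6) * (a + c + g) * (2 * b + g)" for a b c g
    by (simp only: poly4_def poly_mult) (simp add: lin_def algebra_simps)
  moreover have "lin 2 2 2 3 6 * lin 1 0 1 1 0 * lin 0 2 0 1 0 \<noteq> 0"
    unfolding mult_eq_0_iff by (simp add: lin_def)
  ultimately show ?thesis by blast
qed

theorem theorem3p6:
  "generically (\<lambda>a b c g.
     \<forall>s \<in> {1, - 1 :: complex}.
       admits_shift_operator (SE3 a b c g) (SE3 (a + s) b c g) \<and>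
       admits_shift_operator (SE3 a b c g) (SE3 a (b + s) c g) \<and>
       admits_shift_operator (SE3 a b c g) (SE3 a b (c + s) g) \<and>
       admits_shift_operator (SE3 a b c g) (SE3 a b c (g + 2 * s)))"
proof -
  from ex_poly4_exceptional obtain F where "F \<noteq> 0" and F: "\<And>a b c g. poly4 F a b c g =
    (2 * a + 2 * b + 2 * c + 3 * g + 6) * (a + c + g) * (2 * b + g)"
    by blast
  then show ?thesis
    unfolding generically_def
    using SE3_shift_a_plus SE3_shift_a_minus SE3_shift_b_plus SE3_shift_b_minus
      SE3_shift_c_plus SE3_shift_c_minus SE3_shift_g_plus SE3_shift_g_minus
    by (intro exI[of _ F]) simp
qed

end
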